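(* Let $F_q$ be the finite field with $q$ elements. For every $n\geq 1$, the number of $GL_{n}(F_{q})$ double cosets in $GL_{n+1}(F_{q})$, up to the center of $GL_{n+1}(F_{q})$, which are not preserved under transpose is $2$. That is, with $G=GL_{n+1}(F_q)$ and $H=GL_n(F_q)$, exactly two elements of $H\setminus G/Z(G)H$ are not mapped to themselves by the map induced by $g\mapsto g^{t}$.
   Context: $GL_n(F_q)$ is viewed as a subgroup of $GL_{n+1}(F_q)$ via the standard embedding $B\mapsto\begin{pmatrix}B&0\\0&1\end{pmatrix}$. $Z(G)$ is the center of $G$ (the scalar matrices), and $H\setminus G/Z(G)H$ is the set of double cosets $HgZ(G)H$, $g\in G$. Since transpose is an anti-involution of $G$ preserving $H$ and $Z(G)$, it maps such double cosets to such double cosets. *)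

theory Defs
  imports "HOL-Algebra.Coset" "Jordan_Normal_Form.Matrix"
begin

definition GL :: "'a::field itself \<Rightarrow> nat \<Rightarrow> 'a mat monoid" where
  "GL ty n = units_of (ring_mat ty n ())"

definition GL_embed :: "'a::field mat \<Rightarrow> 'a mat" where
  "GL_embed B = four_block_mat B (0\<^sub>m (dim_row B) 1) (0\<^sub>m 1 (dim_col B)) (1\<^sub>m 1)"

definition GL_sub :: "'a::field itself \<Rightarrow> nat \<Rightarrow> 'a mat set" where
  "GL_sub ty n = GL_embed ` carrier (GL ty n)"

definition group_center :: "('a, 'b) monoid_scheme \<Rightarrow> 'a set" where
  "group_center G = {z \<in> carrier G. \<forall>g \<in> carrier G. z \<otimes>\<^bsub>G\<^esub> g = g \<otimes>\<^bsub>G\<^esub> z}"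

definition double_cosets :: "('a, 'b) monoid_scheme \<Rightarrow> 'a set \<Rightarrow> 'a set \<Rightarrow> 'a set set" where
  "double_cosets G H K = (\<lambda>g. (H #>\<^bsub>G\<^esub> g) <#>\<^bsub>G\<^esub> K) ` carrier G"

end

theory Submission
  imports Defs "Jordan_Normal_Form.Determinant"
begin

text \<open>
  Write \<open>g\<close> in blocks as \<open>(A, b; c, d)\<close>; the double coset action is
  \<open>(A, b, c, d) \<mapsto> (P A Q, P b, c Q, d)\<close> up to a common scalar. For invertible \<open>g\<close>,
  either \<open>M = A\<close> or \<open>M = A + b c\<close> is invertible. If \<open>b\<close> and \<open>c\<close> are both nonzero, there is an
  invertible symmetric \<open>h\<close> taking \<open>M\<inverse> b\<close> to \<open>c\<^sup>T\<close>, and then \<open>P = h M\<inverse>\<close>, \<open>Q = h\<inverse> M\<^sup>T\<close> carry \<open>g\<close>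
  to its transpose; if \<open>b\<close> and \<open>c\<close> both vanish, \<open>h = 1\<close> does. When \<open>b = 0\<close> and \<open>c \<noteq> 0\<close>, the block \<open>A\<close>
  and the scalar \<open>d\<close> are invertible and all such \<open>g\<close> form one double coset, which is not preserved
  because the center consists of scalars. The case \<open>b \<noteq> 0\<close>, \<open>c = 0\<close> is its transpose.
\<close>

section \<open>Matrix form of the general linear group\<close>

lemma mem_GL: "A \<in> carrier (GL TYPE('a::field) n) \<longleftrightarrow> A \<in> carrier_mat n n \<and> det A \<noteq> 0"
proof
  assume "A \<in> carrier (GL TYPE('a) n)"
  then have U: "A \<in> Units (ring_mat TYPE('a) n ())"
    by (simp add: GL_def units_of_def)
  then show "A \<in> carrier_mat n n \<and> det A \<noteq> 0"
    using unit_imp_det_non_zero[OF U] by (auto simp: Units_def ring_mat_simps)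
next
  assume "A \<in> carrier_mat n n \<and> det A \<noteq> 0"
  then show "A \<in> carrier (GL TYPE('a) n)"
    using det_non_zero_imp_unit[of A n "()"] by (simp add: GL_def units_of_def)
qed

lemma GL_carrier_mat: "A \<in> carrier (GL TYPE('a::field) n) \<Longrightarrow> A \<in> carrier_mat n n"
  by (simp add: mem_GL)

lemma mult_GL [simp]: "A \<otimes>\<^bsub>GL TYPE('a::field) n\<^esub> B = A * B"
  by (simp add: GL_def units_of_def ring_mat_simps)

lemma one_in_GL [simp]: "1\<^sub>m n \<in> carrier (GL TYPE('a::field) n)"
  by (simp add: mem_GL)

lemma mult_in_GL [simp]:
  "A \<in> carrier (GL TYPE('a::field) n) \<Longrightarrow> B \<in> carrier (GL TYPE('a) n) \<Longrightarrow> A * B \<in> carrier (GL TYPE('a) n)"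
  by (auto simp: mem_GL det_mult)

lemma transpose_in_GL [simp]:
  "A \<in> carrier (GL TYPE('a::field) n) \<Longrightarrow> transpose_mat A \<in> carrier (GL TYPE('a) n)"
  by (auto simp: mem_GL det_transpose)

lemma smult_in_GL [simp]:
  "A \<in> carrier (GL TYPE('a::field) n) \<Longrightarrow> a \<noteq> 0 \<Longrightarrow> a \<cdot>\<^sub>m A \<in> carrier (GL TYPE('a) n)"
  by (auto simp: mem_GL)

lemma GL_inverse:
  assumes "A \<in> carrier (GL TYPE('a::field) n)"
  obtains B where "B \<in> carrier (GL TYPE('a) n)" "A * B = 1\<^sub>m n" "B * A = 1\<^sub>m n"
proof -
  have "A \<in> Units (ring_mat TYPE('a) n ())"
    using assms by (simp add: GL_def units_of_def)
  then obtain B where B: "B \<in> carrier_mat n n" "A * B = 1\<^sub>m n" "B * A = 1\<^sub>m n"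
    by (auto simp: Units_def ring_mat_simps)
  moreover from this have "det B \<noteq> 0"
    using det_mult[of A n B] assms by (auto simp: mem_GL)
  ultimately show thesis using that by (simp add: mem_GL)
qed

lemma left_inverse_cancel:
  fixes A :: "'a::field mat"
  assumes "A \<in> carrier_mat n n" "B \<in> carrier_mat n n" "A * B = 1\<^sub>m n" "X \<in> carrier_mat n m"
  shows "A * (B * X) = X"
  using assms assoc_mult_mat[of A n n B n X m] by simp

section \<open>Invertible and symmetric matrices with a prescribed action on a column\<close>

text \<open>A singular matrix over a field has a nonzero kernel vector. The row equations are
  spelled out as sums so that the explicit matrices built below can be tested one row at a
  time.\<close>

lemma det_nonzeroI:
  fixes A :: "'a::field mat"
  assumes "A \<in> carrier_mat n n"
    and "\<And>v k. v \<in> carrier_vec n \<Longrightarrow> (\<And>i. i < n \<Longrightarrow> (\<Sum>l<n. A $$ (i, l) * v $ l) = 0) \<Longrightarrow> k < n \<Longrightarrow> v $ k = 0"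
  shows "det A \<noteq> 0"
proof
  assume "det A = 0"
  then obtain v where v: "v \<in> carrier_vec n" "v \<noteq> 0\<^sub>v n" "A *\<^sub>v v = 0\<^sub>v n"
    using det_0_iff_vec_prod_zero_field[OF assms(1)] by blast
  have "(\<Sum>l<n. A $$ (i, l) * v $ l) = 0" if "i < n" for i
  proof -
    have "(A *\<^sub>v v) $ i = (\<Sum>l<n. A $$ (i, l) * v $ l)"
      using assms(1) v(1) that by (auto simp: scalar_prod_def atLeast0LessThan intro!: sum.cong)
    then show ?thesis using v(3) that by simp
  qed
  then have "v = 0\<^sub>v n" using assms(2)[OF v(1)] v(1) by (intro eq_vecI) auto
  with v(2) show False by simp
qed

text \<open>Vectors are \<open>n \<times> 1\<close> and \<open>1 \<times> n\<close> matrices, so that they can serve as blocks.\<close>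

definition unit_col :: "nat \<Rightarrow> 'a::field mat" where
  "unit_col n = mat n 1 (\<lambda>(i, j). if i = 0 then 1 else 0)"

lemma unit_col_carrier: "unit_col n \<in> carrier_mat n 1"
  by (simp add: unit_col_def)

lemmas [simp] = unit_col_carrier[simplified]

lemma mult_unit_col:
  assumes "A \<in> carrier_mat m n" "n \<ge> 1"
  shows "A * unit_col n = mat m 1 (\<lambda>(i, j). A $$ (i, 0))"
proof (rule eq_matI)
  fix i j assume "i < dim_row (mat m 1 (\<lambda>(i, j). A $$ (i, 0)))" "j < dim_col (mat m 1 (\<lambda>(i, j). A $$ (i, 0)))"
  then have ij: "i < m" "j = 0" by auto
  have "(A * unit_col n) $$ (i, j) = (\<Sum>l<n. A $$ (i, l) * (if l = 0 then 1 else 0))"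
    using assms ij by (auto simp: scalar_prod_def unit_col_def atLeast0LessThan intro!: sum.cong)
  also have "\<dots> = A $$ (i, 0)"
    using assms by (simp add: if_distrib[of "(*) _"] sum.delta cong: if_cong)
  finally show "(A * unit_col n) $$ (i, j) = mat m 1 (\<lambda>(i, j). A $$ (i, 0)) $$ (i, j)"
    using ij by simp
qed (use assms in \<open>auto simp: unit_col_def\<close>)

lemma nonzero_col_entry:
  assumes "b \<in> carrier_mat n 1" "b \<noteq> 0\<^sub>m n 1"
  obtains i where "i < n" "b $$ (i, 0) \<noteq> 0"
proof (rule ccontr)
  assume "\<not> thesis"
  then have "b = 0\<^sub>m n 1" using assms(1) that by (intro eq_matI) auto
  with assms(2) show False by simp
qed

text \<open>Basis completion: at an index \<open>i\<close> where \<open>b\<close> is nonzero,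
  \<open>b\<close> can replace the \<open>i\<close>-th unit vector. Putting \<open>b\<close> first
  makes it the image of \<open>unit_col n\<close>.\<close>

lemma GL_transitive_on_nonzero:
  assumes "b \<in> carrier_mat n 1" "b \<noteq> 0\<^sub>m n 1"
  obtains R where "R \<in> carrier (GL TYPE('a::field) n)" "R * unit_col n = b"
proof -
  obtain i where i: "i < n" "b $$ (i, 0) \<noteq> 0" using nonzero_col_entry[OF assms] .
  \<comment> \<open>the identity with column \<open>i\<close> replaced by \<open>b\<close>, after swapping columns \<open>0\<close> and \<open>i\<close>\<close>
  define R where "R = mat n n (\<lambda>(k, l). if l = 0 then b $$ (k, 0)
      else if k \<noteq> i \<and> l = (if k = 0 then i else k) then 1 else 0)"
  have R: "R \<in> carrier_mat n n" by (simp add: R_def)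
  have "det R \<noteq> 0"
  proof (rule det_nonzeroI[OF R])
    fix v :: "'a vec" and k
    assume v: "v \<in> carrier_vec n" and eq: "\<And>k. k < n \<Longrightarrow> (\<Sum>l<n. R $$ (k, l) * v $ l) = 0" and k: "k < n"
    \<comment> \<open>Besides column 0, row \<open>k\<close> has at most one nonzero entry; it meets
      \<open>v $ i\<close> for \<open>k = 0\<close> because of the column swap, and is absent for
      \<open>k = i\<close>.\<close>
    have row: "b $$ (k, 0) * v $ 0 + (if k = i then 0 else if k = 0 then v $ i else v $ k) = 0"
      if "k < n" for k
    proof -
      have "(\<Sum>l<n. R $$ (k, l) * v $ l) = (\<Sum>l<n. (if l = 0 then b $$ (k, 0) * v $ l else 0)
          + (if l = (if k = 0 then i else k) then if k = i then 0 else v $ l else 0))"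
        using that i by (intro sum.cong) (auto simp: R_def)
      also have "\<dots> = b $$ (k, 0) * v $ 0 + (if k = i then 0 else if k = 0 then v $ i else v $ k)"
        using that i by (auto simp: sum.distrib sum.delta)
      finally show ?thesis using eq[OF that] by simp
    qed
    \<comment> \<open>Row \<open>i\<close> has only the entry \<open>b $$ (i, 0)\<close>, so it
      determines \<open>v $ 0\<close>; each other row then yields one further coordinate, row 0
      yielding \<open>v $ i\<close>.\<close>
    have v0: "v $ 0 = 0" using row[OF i(1)] i by simp
    show "v $ k = 0"
    proof (cases "k = i")
      case True
      then show ?thesis using v0 row[of 0] i by (cases "i = 0") auto
    next
      case False
      then show ?thesis using v0 row[OF k] by (cases "k = 0") auto
    qed
  qed
  moreover have "R * unit_col n = b"
    using mult_unit_col[OF R] i(1) assms(1) by (intro eq_matI) (auto simp: R_def)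
  ultimately show thesis using that R by (simp add: mem_GL)
qed

text \<open>Symmetry forces \<open>c\<close> into the first row as well as the first column. The
  rest is an identity block with the \<open>j\<close>-th diagonal entry deleted, where
  \<open>c\<close> is nonzero at \<open>j\<close>: then row and column \<open>j\<close> meet the
  border only in that nonzero entry. This works in every characteristic.\<close>

lemma symmetric_GL_with_first_col:
  assumes "c \<in> carrier_mat n 1" "c \<noteq> 0\<^sub>m n 1"
  obtains S where "S \<in> carrier (GL TYPE('a::field) n)" "S * unit_col n = c" "transpose_mat S = S"
proof -
  \<comment> \<open>\<open>j = 0\<close> is used only if \<open>c\<close> is a multiple of the first unit vector\<close>
  obtain j where j: "j < n" "c $$ (j, 0) \<noteq> 0" "\<And>k. j = 0 \<Longrightarrow> k \<noteq> 0 \<Longrightarrow> k < n \<Longrightarrow> c $$ (k, 0) = 0"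
  proof (cases "\<exists>k<n. k \<noteq> 0 \<and> c $$ (k, 0) \<noteq> 0")
    case False
    then show ?thesis using that nonzero_col_entry[OF assms] by metis
  qed (use that in blast)
  define S where "S = mat n n (\<lambda>(k, l). if l = 0 then c $$ (k, 0) else if k = 0 then c $$ (l, 0)
      else if k = l \<and> k \<noteq> j then 1 else 0)"
  have S: "S \<in> carrier_mat n n" by (simp add: S_def)
  have "det S \<noteq> 0"
  proof (rule det_nonzeroI[OF S])
    fix v :: "'a vec" and k
    assume v: "v \<in> carrier_vec n" and eq: "\<And>k. k < n \<Longrightarrow> (\<Sum>l<n. S $$ (k, l) * v $ l) = 0" and k: "k < n"
    have row: "c $$ (k, 0) * v $ 0 + (if k = j then 0 else v $ k) = 0" if "k < n" "k \<noteq> 0" for k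
    proof -
      have "(\<Sum>l<n. S $$ (k, l) * v $ l) = (\<Sum>l<n. (if l = 0 then c $$ (k, 0) * v $ l else 0)
          + (if l = k then if k = j then 0 else v $ l else 0))"
        using that by (intro sum.cong) (auto simp: S_def)
      also have "\<dots> = c $$ (k, 0) * v $ 0 + (if k = j then 0 else v $ k)"
        using that by (auto simp: sum.distrib sum.delta)
      finally show ?thesis using eq[OF that(1)] by simp
    qed
    have off: "v $ k = 0" if "k < n" "k \<noteq> j" for k
    proof (cases "j = 0")
      case True
      then show ?thesis using row[of k] j(3) that by auto
    next
      case False
      \<comment> \<open>The deleted diagonal entry leaves \<open>c $$ (j, 0)\<close> alone in row
        \<open>j\<close>, so \<open>v $ 0\<close> vanishes first and the remaining unit diagonal
        entries give the other coordinates.\<close>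
      then have "v $ 0 = 0" using row[of j] j by auto
      then show ?thesis using row[of k] that by (cases "k = 0") auto
    qed
    \<comment> \<open>Only \<open>v $ j\<close> is still open, and row 0 multiplies it by the
      nonzero \<open>c $$ (j, 0)\<close>.\<close>
    have "(\<Sum>l<n. S $$ (0, l) * v $ l) = (\<Sum>l<n. if l = j then c $$ (j, 0) * v $ j else 0)"
      using off j(1) by (intro sum.cong) (auto simp: S_def)
    also have "\<dots> = c $$ (j, 0) * v $ j" using j(1) by simp
    finally have "c $$ (j, 0) * v $ j = 0" using eq[of 0] j(1) by simp
    then have "v $ j = 0" using j(2) by simp
    then show "v $ k = 0" using off[OF k] by (cases "k = j") auto
  qed
  moreover have "S * unit_col n = c"
    using mult_unit_col[OF S] j(1) assms(1) by (intro eq_matI) (auto simp: S_def)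
  moreover have "transpose_mat S = S"
    by (rule eq_matI) (auto simp: S_def)
  ultimately show thesis using that S by (simp add: mem_GL)
qed

text \<open>Congruence preserves symmetry, so a change of basis taking \<open>b\<close> to the first
  unit vector reduces the claim to a symmetric matrix with prescribed first column.\<close>

lemma symmetric_GL_maps_to:
  assumes b: "b \<in> carrier_mat n 1" "b \<noteq> 0\<^sub>m n 1" and c: "c \<in> carrier_mat n 1" "c \<noteq> 0\<^sub>m n 1"
  obtains h where "h \<in> carrier (GL TYPE('a::field) n)" "h * b = c" "transpose_mat h = h"
proof -
  obtain R where R: "R \<in> carrier (GL TYPE('a) n)" "R * unit_col n = b"
    using GL_transitive_on_nonzero[OF b] .
  obtain R' where R': "R' \<in> carrier (GL TYPE('a) n)" "R * R' = 1\<^sub>m n" "R' * R = 1\<^sub>m n"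
    using GL_inverse[OF R(1)] .
  have [simp]: "R \<in> carrier_mat n n" "R' \<in> carrier_mat n n" using R R' by (auto simp: mem_GL)
  have RT: "transpose_mat R' * transpose_mat R = 1\<^sub>m n"
    using R'(2) transpose_mult[of R n n R' n] by simp
  \<comment> \<open>The first column is chosen so that the congruence by \<open>R'\<close> turns it
    back into \<open>c\<close>.\<close>
  let ?c = "transpose_mat R * c"
  have c': "transpose_mat R' * ?c = c"
    using RT c(1) by (simp add: assoc_mult_mat[of _ n n _ n _ 1, symmetric])
  have "transpose_mat R' * 0\<^sub>m n 1 = 0\<^sub>m n 1" by (rule right_mult_zero_mat) simp
  then have "?c \<noteq> 0\<^sub>m n 1" using c' c(2) by metis
  then obtain S where S: "S \<in> carrier (GL TYPE('a) n)" "S * unit_col n = ?c" "transpose_mat S = S"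
    using symmetric_GL_with_first_col[of ?c n] c(1) by (metis R(1) mult_carrier_mat transpose_in_GL GL_carrier_mat)
  let ?h = "transpose_mat R' * S * R'"
  have [simp]: "S \<in> carrier_mat n n" using S by (simp add: mem_GL)
  have [simp]: "transpose_mat R' * S \<in> carrier_mat n n" by (rule mult_carrier_mat[of _ n n]) simp_all
  have "R' * b = unit_col n"
    using left_inverse_cancel[OF _ _ R'(3) unit_col_carrier] R(2) by simp
  then have "?h * b = transpose_mat R' * (S * unit_col n)"
    using b(1) by (simp add: assoc_mult_mat[of _ n n _ n _ 1])
  then have "?h * b = c" using S(2) c' by simp
  moreover have "transpose_mat ?h = ?h"
    using S(3) transpose_mult[of "transpose_mat R' * S" n n R' n] transpose_mult[of "transpose_mat R'" n n S n]
      assoc_mult_mat[of "transpose_mat R'" n n S n R' n] by simp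
  moreover have "?h \<in> carrier (GL TYPE('a) n)" using S R' by simp
  ultimately show thesis using that by blast
qed

section \<open>A rank-one correction that makes the corner block invertible\<close>

lemma GL_mult_eq_0:
  assumes "R \<in> carrier (GL TYPE('a::field) n)" "X \<in> carrier_mat n m" "R * X = 0\<^sub>m n m"
  shows "X = 0\<^sub>m n m"
proof -
  obtain S where S: "S \<in> carrier (GL TYPE('a) n)" "S * R = 1\<^sub>m n"
    using GL_inverse[OF assms(1)] by blast
  have "S * (R * X) = X"
    using left_inverse_cancel[OF _ _ S(2) assms(2)] S(1) assms(1) by (simp add: GL_carrier_mat)
  then show ?thesis
    using S(1) assms(3) by (simp add: GL_carrier_mat right_mult_zero_mat[of S n n])
qed

lemma singular_kernel_col:
  fixes A :: "'a::field mat"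
  assumes "A \<in> carrier_mat n n" "det A = 0"
  obtains u where "u \<in> carrier_mat n 1" "u \<noteq> 0\<^sub>m n 1" "A * u = 0\<^sub>m n 1"
proof -
  obtain v where v: "v \<in> carrier_vec n" "v \<noteq> 0\<^sub>v n" "A *\<^sub>v v = 0\<^sub>v n"
    using det_0_iff_vec_prod_zero_field[OF assms(1)] assms(2) by blast
  let ?u = "mat n 1 (\<lambda>(i, j). v $ i)"
  have c: "col ?u 0 = v" using v(1) by (intro eq_vecI) auto
  have "A * ?u = 0\<^sub>m n 1"
  proof (rule eq_matI)
    fix i j assume "i < dim_row (0\<^sub>m n 1 :: 'a mat)" "j < dim_col (0\<^sub>m n 1 :: 'a mat)"
    then have ij: "i < n" "j = 0" by auto
    have "(A *\<^sub>v v) $ i = 0" using v(3) ij by simp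
    then show "(A * ?u) $$ (i, j) = 0\<^sub>m n 1 $$ (i, j)"
      using ij assms(1) c by simp
  qed (use assms(1) in auto)
  moreover have "?u \<noteq> 0\<^sub>m n 1"
  proof
    assume "?u = 0\<^sub>m n 1"
    then have "v = col (0\<^sub>m n 1) 0" using c by simp
    then have "v = 0\<^sub>v n" by simp
    then show False using v(2) by simp
  qed
  ultimately show thesis using that[of ?u] by simp
qed

lemma mult_1_1_eq_0:
  fixes E F :: "'a::field mat"
  assumes "E \<in> carrier_mat 1 1" "F \<in> carrier_mat 1 1" "E * F = 0\<^sub>m 1 1"
  shows "E = 0\<^sub>m 1 1 \<or> F = 0\<^sub>m 1 1"
proof -
  have "(E * F) $$ (0, 0) = 0" using assms(3) by simp
  then have "E $$ (0, 0) * F $$ (0, 0) = 0"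
    using assms(1,2) by (simp add: scalar_prod_def)
  moreover have "X = 0\<^sub>m 1 1" if "X \<in> carrier_mat 1 1" "X $$ (0, 0) = 0" for X :: "'a mat"
    using that by (intro eq_matI) auto
  ultimately show ?thesis using assms(1,2) by auto
qed

text \<open>Extending \<open>u\<close> by a final zero gives a column killed by the invertible block
  matrix.\<close>

lemma GL_block_annihilates_col:
  assumes "A \<in> carrier_mat n n" "b \<in> carrier_mat n 1" "c \<in> carrier_mat 1 n" "d \<in> carrier_mat 1 1"
    and "four_block_mat A b c d \<in> carrier (GL TYPE('a::field) (n + 1))"
    and "u \<in> carrier_mat n 1" "A * u = 0\<^sub>m n 1" "c * u = 0\<^sub>m 1 1"
  shows "u = 0\<^sub>m n 1"
proof -
  \<comment> \<open>This is \<open>u\<close> above a zero; the right-hand blocks have no columns and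
    only serve the block product rule.\<close>
  let ?x = "four_block_mat u (0\<^sub>m n 0) (0\<^sub>m 1 1) (0\<^sub>m 1 0)"
  have x: "?x \<in> carrier_mat (n + 1) 1" using assms(6) by auto
  have "four_block_mat A b c d * ?x = 0\<^sub>m (n + 1) 1"
    using assms by (subst mult_four_block_mat[of _ n n _ 1 _ 1 _ _ 1 _ 0]) (auto intro!: eq_matI)
  then have x0: "?x = 0\<^sub>m (n + 1) 1" using GL_mult_eq_0[OF assms(5) x] by simp
  show ?thesis
  proof (rule eq_matI)
    fix i j assume "i < dim_row (0\<^sub>m n 1 :: 'a mat)" "j < dim_col (0\<^sub>m n 1 :: 'a mat)"
    then have ij: "i < n" "j = 0" by auto
    have "?x $$ (i, j) = 0" using x0 ij by simp
    then show "u $$ (i, j) = 0\<^sub>m n 1 $$ (i, j)" using ij assms(6) by simp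
  qed (use assms(6) in auto)
qed

text \<open>If both candidates were singular, take a column \<open>u\<close> killed by
  \<open>A + b * c\<close> and a row \<open>w\<close> killing \<open>A\<close> from the left. Then
  \<open>0 = w (A + b c) u = (w b)(c u)\<close>, so one scalar vanishes, and \<open>w\<close> or
  \<open>u\<close> extended by zero is a left or right null vector of the invertible block matrix.
  The correction is kept as \<open>X\<close> so that both cases can be handled together
  later.\<close>

lemma GL_rank_one_correction:
  assumes A: "A \<in> carrier_mat n n" and b: "b \<in> carrier_mat n 1"
    and c: "c \<in> carrier_mat 1 n" and d: "d \<in> carrier_mat 1 1"
    and g: "four_block_mat A b c d \<in> carrier (GL TYPE('a::field) (n + 1))"
  obtains X where "X = 0\<^sub>m n n \<or> X = b * c" "A + X \<in> carrier (GL TYPE('a) n)"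
proof (cases "det A = 0")
  case False
  then show thesis using that[of "0\<^sub>m n n"] A by (simp add: mem_GL)
next
  case True
  have bc: "b * c \<in> carrier_mat n n" using b c by simp
  have "det (A + b * c) \<noteq> 0"
  proof
    assume "det (A + b * c) = 0"
    then obtain u where u: "u \<in> carrier_mat n 1" "u \<noteq> 0\<^sub>m n 1" "(A + b * c) * u = 0\<^sub>m n 1"
      using singular_kernel_col[of "A + b * c" n] A bc by auto
    have "det (transpose_mat A) = 0" using det_transpose[OF A] True by simp
    then obtain w where w: "w \<in> carrier_mat n 1" "w \<noteq> 0\<^sub>m n 1" "transpose_mat A * w = 0\<^sub>m n 1"
      using singular_kernel_col[of "transpose_mat A" n] A by auto
    let ?w = "transpose_mat w"
    have wT: "?w \<in> carrier_mat 1 n" using w(1) by simp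
    have cu: "c * u \<in> carrier_mat 1 1" using c u(1) by simp
    have wb: "?w * b \<in> carrier_mat 1 1" using wT b by simp
    have wA: "?w * A = 0\<^sub>m 1 n"
      using w(1,3) A transpose_mult[of "transpose_mat A" n n w 1] by simp
    have split: "(A + b * c) * u = A * u + b * (c * u)"
      using A b c u(1) bc by (simp add: add_mult_distrib_mat[of _ n n] assoc_mult_mat[of _ n 1 _ n _ 1])
    have "?w * (A * u + b * (c * u)) = ?w * (A * u) + ?w * (b * (c * u))"
      using wT A b u(1) cu by (intro mult_add_distrib_mat[of _ 1 n]) auto
    also have "?w * (A * u) = 0\<^sub>m 1 1"
      using wA assoc_mult_mat[OF wT A u(1)] left_mult_zero_mat[OF u(1), of 1] by simp
    also have "?w * (b * (c * u)) = (?w * b) * (c * u)"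
      using assoc_mult_mat[OF wT b cu] by simp
    finally have "(?w * b) * (c * u) = ?w * 0\<^sub>m n 1"
      using split u(3) wb cu by simp
    then have "(?w * b) * (c * u) = 0\<^sub>m 1 1"
      using right_mult_zero_mat[OF wT, of 1] by simp
    then consider "?w * b = 0\<^sub>m 1 1" | "c * u = 0\<^sub>m 1 1"
      using mult_1_1_eq_0[OF wb cu] by blast
    then show False
    proof cases
      case 1
      \<comment> \<open>The left null vector is treated as a right null vector of the transposed
        block matrix.\<close>
      have "transpose_mat (four_block_mat A b c d)
          = four_block_mat (transpose_mat A) (transpose_mat c) (transpose_mat b) (transpose_mat d)"
        using A b c d by (rule transpose_four_block_mat)
      then have "four_block_mat (transpose_mat A) (transpose_mat c) (transpose_mat b) (transpose_mat d)
          \<in> carrier (GL TYPE('a) (n + 1))"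
        using transpose_in_GL[OF g] by simp
      moreover have "transpose_mat b * w = 0\<^sub>m 1 1"
        using 1 transpose_mult[OF wT b] by simp
      ultimately show False
        using GL_block_annihilates_col[of "transpose_mat A" n "transpose_mat c" "transpose_mat b" "transpose_mat d" w]
          A b c d w by simp
    next
      case 2
      \<comment> \<open>Once \<open>c * u\<close> vanishes, the kernel equation for
        \<open>A + b * c\<close> reduces to \<open>A * u = 0\<close>.\<close>
      have "b * 0\<^sub>m 1 1 = 0\<^sub>m n 1" using b by (rule right_mult_zero_mat)
      then have "A * u = 0\<^sub>m n 1" using split u 2 A by simp
      then show False using GL_block_annihilates_col[OF A b c d g u(1) _ 2] u(2) by simp
    qed
  qed
  then show thesis using that[of "b * c"] A bc by (simp add: mem_GL)
qed

section \<open>Carrying a matrix to its transpose inside its double coset\<close>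

lemma GL_embed_block_mult:
  fixes A :: "'a::field mat"
  assumes "P \<in> carrier_mat n n" "Q \<in> carrier_mat n n" "A \<in> carrier_mat n n" "b \<in> carrier_mat n 1"
    "c \<in> carrier_mat 1 n" "d \<in> carrier_mat 1 1"
  shows "GL_embed P * four_block_mat A b c d * GL_embed Q = four_block_mat (P * A * Q) (P * b) (c * Q) d"
proof -
  have "GL_embed P * four_block_mat A b c d = four_block_mat (P * A) (P * b) c d"
    unfolding GL_embed_def using assms
    by (subst mult_four_block_mat[of _ n n _ 1 _ 1 _ _ n _ 1]) (auto simp: left_mult_zero_mat[of _ n] left_mult_zero_mat[of _ 1])
  moreover have "\<dots> * GL_embed Q = four_block_mat (P * A * Q) (P * b) (c * Q) d"
    unfolding GL_embed_def using assms
    by (subst mult_four_block_mat[of _ n n _ 1 _ 1 _ _ n _ 1]) (auto simp: right_mult_zero_mat[of _ n n] right_mult_zero_mat[of _ 1 n] right_mult_zero_mat[of _ n 1] right_mult_zero_mat[of _ 1 1])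
  ultimately show ?thesis by simp
qed

text \<open>The choice of \<open>h\<close> gives \<open>P b\<close> as the transpose of
  \<open>c\<close>, and its symmetry gives \<open>c Q\<close> as the transpose of \<open>b\<close>.
  Hence \<open>P\<close>, \<open>Q\<close> transpose \<open>b * c\<close> automatically, and they
  transpose \<open>A + X\<close> by cancellation, so subtracting the \<open>X\<close> part shows
  that they transpose \<open>A\<close>.\<close>

lemma transpose_double_coset_equiv:
  assumes A: "A \<in> carrier_mat n n" and b: "b \<in> carrier_mat n 1"
    and c: "c \<in> carrier_mat 1 n" and d: "d \<in> carrier_mat 1 1"
    and g: "four_block_mat A b c d \<in> carrier (GL TYPE('a::field) (n + 1))"
    and bc: "b = 0\<^sub>m n 1 \<longleftrightarrow> c = 0\<^sub>m 1 n"
  obtains P Q where "P \<in> carrier (GL TYPE('a) n)" "Q \<in> carrier (GL TYPE('a) n)"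
    "transpose_mat (four_block_mat A b c d) = GL_embed P * four_block_mat A b c d * GL_embed Q"
proof -
  obtain X where X: "X = 0\<^sub>m n n \<or> X = b * c" and M: "A + X \<in> carrier (GL TYPE('a) n)"
    using GL_rank_one_correction[OF A b c d g] .
  let ?M = "A + X"
  obtain M' where M': "M' \<in> carrier (GL TYPE('a) n)" "?M * M' = 1\<^sub>m n" "M' * ?M = 1\<^sub>m n"
    using GL_inverse[OF M] .
  have Xc [simp]: "X \<in> carrier_mat n n" using X b c by auto
  have car [simp]: "M' \<in> carrier_mat n n" using M' by (simp add: GL_carrier_mat)
  note [simp] = A b[simplified] c[simplified] d[simplified]
  \<comment> \<open>The hypothesis on \<open>b\<close> and \<open>c\<close> enters here: an
    invertible \<open>h\<close> can match these columns only if both vanish or neither does.\<close>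
  obtain h where h: "h \<in> carrier (GL TYPE('a) n)" "h * (M' * b) = transpose_mat c" "transpose_mat h = h"
  proof (cases "b = 0\<^sub>m n 1")
    case True
    have "1\<^sub>m n * (M' * b) = transpose_mat c"
      using True bc right_mult_zero_mat[OF car, of 1] by simp
    then show thesis using that[of "1\<^sub>m n"] by simp
  next
    case False
    have "M' * b \<noteq> 0\<^sub>m n 1" using GL_mult_eq_0[OF M'(1) b] False by blast
    moreover have "transpose_mat c \<noteq> 0\<^sub>m n 1"
      using False bc by (metis transpose_transpose zero_transpose_mat)
    ultimately show thesis using that symmetric_GL_maps_to[of "M' * b" n "transpose_mat c"]
      by (metis car b c mult_carrier_mat transpose_carrier_mat)
  qed
  obtain h' where h': "h' \<in> carrier (GL TYPE('a) n)" "h * h' = 1\<^sub>m n" "h' * h = 1\<^sub>m n"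
    using GL_inverse[OF h(1)] .
  have [simp]: "h \<in> carrier_mat n n" "h' \<in> carrier_mat n n" using h h' by (simp_all add: GL_carrier_mat)
  note [simp] = mult_carrier_mat[of _ n n _ n] mult_carrier_mat[of _ n n _ "Suc 0"] mult_carrier_mat[of _ "Suc 0" n _ n]
  let ?P = "h * M'" and ?Q = "h' * transpose_mat ?M"
  have [simp]: "?P \<in> carrier_mat n n" "?Q \<in> carrier_mat n n" by simp_all
  have Pb: "?P * b = transpose_mat c"
    using h(2) by (simp add: assoc_mult_mat[of _ n n _ n _ 1])
  \<comment> \<open>Symmetry of \<open>h\<close> is used here: \<open>c\<close> factors through
    \<open>h\<close> on the right, which \<open>h'\<close> in \<open>?Q\<close> cancels.\<close>
  have "transpose_mat (h * (M' * b)) = c" using h(2) by simp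
  then have "c = transpose_mat (M' * b) * h"
    using h(3) transpose_mult[of h n n "M' * b" 1] by simp
  then have "c * ?Q = transpose_mat (M' * b) * (h * ?Q)"
    by (simp add: assoc_mult_mat[of _ 1 n _ n _ n])
  also have "h * ?Q = transpose_mat ?M"
    using left_inverse_cancel[of h n h' "transpose_mat ?M" n] h'(2) by simp
  also have "transpose_mat (M' * b) * transpose_mat ?M = transpose_mat (?M * (M' * b))"
    by (rule transpose_mult[symmetric, of _ n n _ 1]) simp_all
  also have "?M * (M' * b) = b"
    using left_inverse_cancel[of ?M n M' b 1] M'(2) by simp
  finally have cQ: "c * ?Q = transpose_mat b" .
  have "?P * ?M * ?Q = h * (M' * (?M * ?Q))"
    by (simp add: assoc_mult_mat[of _ n n _ n _ n])
  also have "M' * (?M * ?Q) = ?Q"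
    using left_inverse_cancel[of M' n ?M ?Q n] M'(3) by simp
  also have "h * ?Q = transpose_mat ?M"
    using left_inverse_cancel[of h n h' "transpose_mat ?M" n] h'(2) by simp
  finally have PMQ: "?P * ?M * ?Q = transpose_mat ?M" .
  have PXQ: "?P * X * ?Q = transpose_mat X"
    using X
  proof
    assume "X = 0\<^sub>m n n"
    then show ?thesis
      using right_mult_zero_mat[of ?P n n n] left_mult_zero_mat[of ?Q n n n] by simp
  next
    assume X: "X = b * c"
    have "?P * (b * c) * ?Q = (?P * b) * (c * ?Q)"
      by (smt (verit) assoc_mult_mat b c mult_carrier_mat \<open>?P \<in> carrier_mat n n\<close> \<open>?Q \<in> carrier_mat n n\<close>)
    also have "\<dots> = transpose_mat (b * c)"
      unfolding Pb cQ by (rule transpose_mult[symmetric, of _ n 1 _ n]) simp_all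
    finally show ?thesis using X by simp
  qed
  have "?P * ?M * ?Q = ?P * A * ?Q + ?P * X * ?Q"
    by (simp add: mult_add_distrib_mat[of ?P n n A n X] add_mult_distrib_mat[of "?P * A" n n "?P * X" ?Q n])
  then have sum: "?P * A * ?Q + transpose_mat X = transpose_mat A + transpose_mat X"
    using PMQ PXQ transpose_add[of A n n X] by simp
  have PAQ: "?P * A * ?Q = transpose_mat A"
  proof (rule eq_matI)
    fix i j assume "i < dim_row (transpose_mat A)" "j < dim_col (transpose_mat A)"
    then have ij: "i < n" "j < n" using A by auto
    have "(?P * A * ?Q + transpose_mat X) $$ (i, j) = (transpose_mat A + transpose_mat X) $$ (i, j)"
      unfolding sum ..
    then show "(?P * A * ?Q) $$ (i, j) = transpose_mat A $$ (i, j)"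
      using ij Xc by (simp del: index_mult_mat)
  qed (use carrier_matD[OF A] carrier_matD[OF Xc] carrier_matD[of h n n] in auto)
  have "transpose_mat d = d"
    using carrier_matD[OF d] by (intro eq_matI) auto
  then have "transpose_mat (four_block_mat A b c d) = GL_embed ?P * four_block_mat A b c d * GL_embed ?Q"
    using transpose_four_block_mat[OF A b c d] GL_embed_block_mult[of ?P n ?Q A b c d] PAQ Pb cQ by simp
  moreover have "?P \<in> carrier (GL TYPE('a) n)" "?Q \<in> carrier (GL TYPE('a) n)"
    using h h' M M' by simp_all
  ultimately show thesis using that by blast
qed

section \<open>The center consists of the nonzero scalar matrices\<close>

lemma GL_center:
  assumes "n > 0"
  shows "group_center (GL TYPE('a::field) n) = {a \<cdot>\<^sub>m 1\<^sub>m n | a. a \<noteq> 0}"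
proof (intro equalityI subsetI)
  fix z assume z: "z \<in> group_center (GL TYPE('a) n)"
  then have zG: "z \<in> carrier (GL TYPE('a) n)"
    and comm: "\<And>g. g \<in> carrier (GL TYPE('a) n) \<Longrightarrow> z * g = g * z"
    by (auto simp: group_center_def)
  have zc: "z \<in> carrier_mat n n" using zG by (rule GL_carrier_mat)
  have off: "z $$ (l, k) = 0" and diag: "z $$ (k, k) = z $$ (l, l)"
    if "k < n" "l < n" "k \<noteq> l" for k l
  proof -
    \<comment> \<open>Commutation is tested on the transvection with an extra 1 at
      \<open>(k, l)\<close>.\<close>
    have "addrow_mat n 1 k l \<in> carrier (GL TYPE('a) n)"
      using that by (simp add: mem_GL det_addrow_mat)
    then have "z * addrow_mat n 1 k l = addrow_mat n 1 k l * z" by (rule comm)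
    \<comment> \<open>One side adds column \<open>k\<close> to column \<open>l\<close>, the other
      adds row \<open>l\<close> to row \<open>k\<close>. Entry \<open>(l, l)\<close> then isolates
      \<open>z $$ (l, k)\<close>, and entry \<open>(k, l)\<close> compares the two diagonal
      entries.\<close>
    then have eq: "addcol 1 l k z = addrow 1 k l z"
      using addcol_mat[OF zc that(1), of 1 l] addrow_mat[OF zc that(2), of 1 k] by simp
    show "z $$ (l, k) = 0" using arg_cong[OF eq, of "\<lambda>M. M $$ (l, l)"] that zc by simp
    show "z $$ (k, k) = z $$ (l, l)" using arg_cong[OF eq, of "\<lambda>M. M $$ (k, l)"] that zc by simp
  qed
  have eq: "z = z $$ (0, 0) \<cdot>\<^sub>m 1\<^sub>m n"
  proof (rule eq_matI)
    fix i j assume "i < dim_row (z $$ (0, 0) \<cdot>\<^sub>m 1\<^sub>m n)" "j < dim_col (z $$ (0, 0) \<cdot>\<^sub>m 1\<^sub>m n)"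
    then have ij: "i < n" "j < n" by auto
    show "z $$ (i, j) = (z $$ (0, 0) \<cdot>\<^sub>m 1\<^sub>m n) $$ (i, j)"
      using ij off[of j i] diag[of i 0] assms by (cases "i = j"; cases "i = 0") auto
  qed (use zc in auto)
  moreover have "z $$ (0, 0) \<noteq> 0"
  proof
    assume "z $$ (0, 0) = 0"
    then have "det (0 \<cdot>\<^sub>m 1\<^sub>m n :: 'a mat) \<noteq> 0" using eq zG by (simp add: mem_GL)
    then show False using assms by simp
  qed
  ultimately show "z \<in> {a \<cdot>\<^sub>m 1\<^sub>m n | a. a \<noteq> 0}" by blast
next
  fix z assume "z \<in> {a \<cdot>\<^sub>m 1\<^sub>m n | a :: 'a. a \<noteq> 0}"
  then obtain a :: 'a where a: "a \<noteq> 0" "z = a \<cdot>\<^sub>m 1\<^sub>m n" by blast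
  have "z * g = g * z" if "g \<in> carrier (GL TYPE('a) n)" for g
    using GL_carrier_mat[OF that] a(2) mult_smult_assoc_mat[of "1\<^sub>m n" n n g n a]
      mult_smult_distrib[of g n n "1\<^sub>m n" n a] by simp
  then show "z \<in> group_center (GL TYPE('a) n)"
    using a by (simp add: group_center_def)
qed

section \<open>The embedding, double cosets up to scalars, and transposition\<close>

lemma GL_embed_carrier: "P \<in> carrier_mat n n \<Longrightarrow> GL_embed P \<in> carrier_mat (n + 1) (n + 1)"
  unfolding GL_embed_def by (rule four_block_carrier_mat) simp_all

lemma one_smult_mat: "1 \<cdot>\<^sub>m A = (A :: 'a::semiring_1 mat)"
  by (rule eq_matI) simp_all

lemma smult_smult_mat: "a \<cdot>\<^sub>m (b \<cdot>\<^sub>m A) = (a * b) \<cdot>\<^sub>m (A :: 'a::semigroup_mult mat)"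
  by (rule eq_matI) (simp_all add: mult.assoc)

lemma transpose_smult: "transpose_mat (a \<cdot>\<^sub>m A) = a \<cdot>\<^sub>m transpose_mat A"
  by (rule eq_matI) simp_all

lemma smult_zero_mat: "a \<cdot>\<^sub>m 0\<^sub>m n m = (0\<^sub>m n m :: 'a::mult_zero mat)"
  by (rule eq_matI) simp_all

lemma GL_embed_one: "GL_embed (1\<^sub>m n) = (1\<^sub>m (n + 1) :: 'a::field mat)"
  by (simp add: GL_embed_def del: One_nat_def)

lemma GL_embed_mult:
  assumes "P \<in> carrier_mat n n" "Q \<in> carrier_mat n n"
  shows "GL_embed P * GL_embed Q = GL_embed (P * Q :: 'a::field mat)"
  using GL_embed_block_mult[of P n Q "1\<^sub>m n" "0\<^sub>m n 1" "0\<^sub>m 1 n" "1\<^sub>m 1"] assms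
    GL_embed_carrier[OF assms(1)] right_mult_zero_mat[OF assms(1), of 1] left_mult_zero_mat[OF assms(2), of 1]
  by (simp add: GL_embed_def del: One_nat_def)

lemma transpose_GL_embed:
  assumes "P \<in> carrier_mat n n"
  shows "transpose_mat (GL_embed P) = GL_embed (transpose_mat P :: 'a::field mat)"
  unfolding GL_embed_def using assms
  by (subst transpose_four_block_mat[of _ n n _ 1 _ 1]) auto

text \<open>The double coset \<open>H g Z(G) H\<close>, with the center already replaced by the nonzero scalars.\<close>

definition dcoset :: "nat \<Rightarrow> 'a::field mat \<Rightarrow> 'a mat set" where
  "dcoset n g = {a \<cdot>\<^sub>m (GL_embed P * g * GL_embed Q) | a P Q.
    a \<noteq> 0 \<and> P \<in> carrier (GL TYPE('a) n) \<and> Q \<in> carrier (GL TYPE('a) n)}"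

lemma dcosetI:
  assumes "a \<noteq> 0" "P \<in> carrier (GL TYPE('a::field) n)" "Q \<in> carrier (GL TYPE('a) n)"
  shows "a \<cdot>\<^sub>m (GL_embed P * g * GL_embed Q) \<in> dcoset n g"
  using assms by (auto simp: dcoset_def)

text \<open>Central elements are scalar, so the factor from \<open>Z(G)\<close> moves through the
  product and becomes a single scalar in front.\<close>

lemma double_cosets_GL:
  "double_cosets (GL TYPE('a::field) (n + 1)) (GL_sub TYPE('a) n)
      (group_center (GL TYPE('a) (n + 1)) <#>\<^bsub>GL TYPE('a) (n + 1)\<^esub> GL_sub TYPE('a) n)
    = dcoset n ` carrier (GL TYPE('a) (n + 1))"
  unfolding double_cosets_def
proof (rule image_cong[OF refl])
  fix g assume g: "g \<in> carrier (GL TYPE('a) (n + 1))"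
  have eq: "GL_embed P * g * (a \<cdot>\<^sub>m 1\<^sub>m (n + 1) * GL_embed Q) = a \<cdot>\<^sub>m (GL_embed P * g * GL_embed Q)"
    if "P \<in> carrier (GL TYPE('a) n)" "Q \<in> carrier (GL TYPE('a) n)" for a P Q
  proof -
    have Q: "GL_embed Q \<in> carrier_mat (n + 1) (n + 1)" and P: "GL_embed P * g \<in> carrier_mat (n + 1) (n + 1)"
      using that g GL_embed_carrier GL_carrier_mat by (blast intro: mult_carrier_mat)+
    have "a \<cdot>\<^sub>m 1\<^sub>m (n + 1) * GL_embed Q = a \<cdot>\<^sub>m GL_embed Q"
      using mult_smult_assoc_mat[of "1\<^sub>m (n + 1)" "n + 1" "n + 1" _ "n + 1" a] Q left_mult_one_mat[OF Q] by simp
    then show ?thesis using mult_smult_distrib[OF P Q] by simp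
  qed
  have center: "group_center (GL TYPE('a) (n + 1)) = {a \<cdot>\<^sub>m 1\<^sub>m (n + 1) | a. a \<noteq> 0}"
    by (rule GL_center) simp
  show "(GL_sub TYPE('a) n #>\<^bsub>GL TYPE('a) (n + 1)\<^esub> g) <#>\<^bsub>GL TYPE('a) (n + 1)\<^esub>
      (group_center (GL TYPE('a) (n + 1)) <#>\<^bsub>GL TYPE('a) (n + 1)\<^esub> GL_sub TYPE('a) n) = dcoset n g"
    (is "?L = _")
  proof -
    have "?L = {GL_embed P * g * (a \<cdot>\<^sub>m 1\<^sub>m (n + 1) * GL_embed Q) | a P Q.
        a \<noteq> 0 \<and> P \<in> carrier (GL TYPE('a) n) \<and> Q \<in> carrier (GL TYPE('a) n)}"
      unfolding center r_coset_def set_mult_def GL_sub_def mult_GL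
      by blast
    also have "\<dots> = dcoset n g"
      unfolding dcoset_def using eq by (intro Collect_cong) metis
    finally show ?thesis .
  qed
qed

lemma dcoset_self:
  assumes "g \<in> carrier_mat (n + 1) (n + 1)"
  shows "g \<in> dcoset n g"
proof -
  have "g = 1 \<cdot>\<^sub>m (GL_embed (1\<^sub>m n) * g * GL_embed (1\<^sub>m n))"
    unfolding GL_embed_one one_smult_mat left_mult_one_mat[OF assms] right_mult_one_mat[OF assms] ..
  also have "\<dots> \<in> dcoset n g" by (rule dcosetI) simp_all
  finally show ?thesis .
qed

lemma dcoset_carrier:
  assumes "g \<in> carrier_mat (n + 1) (n + 1)" "g' \<in> dcoset n g"
  shows "(g' :: 'a::field mat) \<in> carrier_mat (n + 1) (n + 1)"
proof -
  obtain a P Q where g': "g' = a \<cdot>\<^sub>m (GL_embed P * g * GL_embed Q)"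
    "P \<in> carrier (GL TYPE('a) n)" "Q \<in> carrier (GL TYPE('a) n)"
    using assms(2) by (auto simp: dcoset_def)
  note e = g'(2,3)[THEN GL_carrier_mat, THEN GL_embed_carrier]
  show ?thesis
    unfolding g'(1) by (rule smult_carrier_mat[OF mult_carrier_mat[OF mult_carrier_mat[OF e(1) assms(1)] e(2)]])
qed

text \<open>Transitivity of the double coset relation: the scalars multiply, and the embedded
  factors combine on each side.\<close>

lemma dcoset_subset:
  assumes g: "g \<in> carrier_mat (n + 1) (n + 1)" and "g' \<in> dcoset n g"
  shows "dcoset n g' \<subseteq> dcoset n (g :: 'a::field mat)"
proof
  obtain a P Q where g': "g' = a \<cdot>\<^sub>m (GL_embed P * g * GL_embed Q)" "a \<noteq> 0"
    "P \<in> carrier (GL TYPE('a) n)" "Q \<in> carrier (GL TYPE('a) n)"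
    using assms(2) by (auto simp: dcoset_def)
  fix x assume "x \<in> dcoset n g'"
  then obtain b R S where x: "x = b \<cdot>\<^sub>m (GL_embed R * g' * GL_embed S)" "b \<noteq> 0"
    "R \<in> carrier (GL TYPE('a) n)" "S \<in> carrier (GL TYPE('a) n)"
    by (auto simp: dcoset_def)
  note c = g'(3,4)[THEN GL_carrier_mat] x(3,4)[THEN GL_carrier_mat]
  let ?m = "n + 1"
  note e = c[THEN GL_embed_carrier]
  have s: "GL_embed P * g * GL_embed Q \<in> carrier_mat ?m ?m"
    using e g by (blast intro: mult_carrier_mat)
  have "GL_embed R * g' * GL_embed S = a \<cdot>\<^sub>m (GL_embed R * (GL_embed P * g * GL_embed Q) * GL_embed S)"
    unfolding g'(1) mult_smult_distrib[OF e(3) s]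
    by (rule mult_smult_assoc_mat[OF mult_carrier_mat[OF e(3) s] e(4)])
  also have "GL_embed R * (GL_embed P * g * GL_embed Q) * GL_embed S
      = (GL_embed R * GL_embed P) * g * (GL_embed Q * GL_embed S)"
    using e g by (smt (verit) assoc_mult_mat mult_carrier_mat)
  also have "\<dots> = GL_embed (R * P) * g * GL_embed (Q * S)"
    using c by (simp add: GL_embed_mult)
  finally have "x = (b * a) \<cdot>\<^sub>m (GL_embed (R * P) * g * GL_embed (Q * S))"
    using x(1) by (simp add: smult_smult_mat)
  also have "\<dots> \<in> dcoset n g"
    using x(2-4) g'(2-4) by (intro dcosetI mult_in_GL) simp_all
  finally show "x \<in> dcoset n g" .
qed

text \<open>The inverses of \<open>a\<close>, \<open>P\<close> and \<open>Q\<close> undo the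
  action.\<close>

lemma dcoset_sym:
  assumes g: "g \<in> carrier_mat (n + 1) (n + 1)" and "g' \<in> dcoset n g"
  shows "(g :: 'a::field mat) \<in> dcoset n g'"
proof -
  obtain a P Q where g': "g' = a \<cdot>\<^sub>m (GL_embed P * g * GL_embed Q)" "a \<noteq> 0"
    "P \<in> carrier (GL TYPE('a) n)" "Q \<in> carrier (GL TYPE('a) n)"
    using assms(2) by (auto simp: dcoset_def)
  obtain P' where P': "P' \<in> carrier (GL TYPE('a) n)" "P' * P = 1\<^sub>m n"
    using GL_inverse[OF g'(3)] by blast
  obtain Q' where Q': "Q' \<in> carrier (GL TYPE('a) n)" "Q * Q' = 1\<^sub>m n"
    using GL_inverse[OF g'(4)] by blast
  let ?m = "n + 1"
  note c = g'(3,4)[THEN GL_carrier_mat] P'(1)[THEN GL_carrier_mat] Q'(1)[THEN GL_carrier_mat]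
  note e = c[THEN GL_embed_carrier]
  have s: "GL_embed P * g * GL_embed Q \<in> carrier_mat ?m ?m"
    using e g by (blast intro: mult_carrier_mat)
  have "GL_embed P' * g' * GL_embed Q' = a \<cdot>\<^sub>m (GL_embed P' * (GL_embed P * g * GL_embed Q) * GL_embed Q')"
    unfolding g'(1) mult_smult_distrib[OF e(3) s]
    by (rule mult_smult_assoc_mat[OF mult_carrier_mat[OF e(3) s] e(4)])
  also have "GL_embed P' * (GL_embed P * g * GL_embed Q) * GL_embed Q'
      = (GL_embed P' * GL_embed P) * g * (GL_embed Q * GL_embed Q')"
    using e g by (smt (verit) assoc_mult_mat mult_carrier_mat)
  also have "\<dots> = g"
    using c g P'(2) Q'(2) by (simp add: GL_embed_mult GL_embed_one del: One_nat_def)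
  finally have "g = inverse a \<cdot>\<^sub>m (GL_embed P' * g' * GL_embed Q')"
    using g'(2) g by (intro eq_matI) auto
  also have "\<dots> \<in> dcoset n g'"
    using g'(2) P'(1) Q'(1) by (intro dcosetI) simp_all
  finally show ?thesis .
qed

lemma dcoset_eqI:
  assumes "g \<in> carrier_mat (n + 1) (n + 1)" "g' \<in> dcoset n g"
  shows "dcoset n g' = dcoset n g"
  using dcoset_subset[OF assms] dcoset_subset[OF dcoset_carrier[OF assms] dcoset_sym[OF assms]] by blast

text \<open>Transposition reverses products, so the left and right embedded factors trade places and
  scalars stay put.\<close>

lemma transpose_dcoset:
  assumes "g \<in> carrier_mat (n + 1) (n + 1)"
  shows "transpose_mat ` dcoset n g = dcoset n (transpose_mat g :: 'a::field mat)"
proof -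
  have sub: "transpose_mat ` dcoset n g \<subseteq> dcoset n (transpose_mat g)"
    if g: "g \<in> carrier_mat (n + 1) (n + 1)" for g :: "'a mat"
  proof (rule image_subsetI)
    fix x assume "x \<in> dcoset n g"
    then obtain a P Q where x: "x = a \<cdot>\<^sub>m (GL_embed P * g * GL_embed Q)" "a \<noteq> 0"
      "P \<in> carrier (GL TYPE('a) n)" "Q \<in> carrier (GL TYPE('a) n)"
      by (auto simp: dcoset_def)
    note c = x(3,4)[THEN GL_carrier_mat]
    note e = c[THEN GL_embed_carrier]
    have "transpose_mat (GL_embed P * g * GL_embed Q)
        = transpose_mat (GL_embed Q) * (transpose_mat g * transpose_mat (GL_embed P))"
      using transpose_mult[OF mult_carrier_mat[OF e(1) g] e(2)] transpose_mult[OF e(1) g] by simp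
    also have "\<dots> = GL_embed (transpose_mat Q) * transpose_mat g * GL_embed (transpose_mat P)"
      using c e g by (simp add: transpose_GL_embed[symmetric] del: One_nat_def)
    finally have "transpose_mat x
        = a \<cdot>\<^sub>m (GL_embed (transpose_mat Q) * transpose_mat g * GL_embed (transpose_mat P))"
      unfolding x(1) by (simp add: transpose_smult)
    also have "\<dots> \<in> dcoset n (transpose_mat g)"
      using x(2-4) by (intro dcosetI transpose_in_GL)
    finally show "transpose_mat x \<in> dcoset n (transpose_mat g)" .
  qed
  \<comment> \<open>The reverse inclusion is the first one applied to the transpose of
    \<open>g\<close>, since transposition is an involution.\<close>
  have "transpose_mat ` dcoset n (transpose_mat g) \<subseteq> dcoset n g"
    using sub[of "transpose_mat g"] assms by simp
  then have "transpose_mat ` transpose_mat ` dcoset n (transpose_mat g) \<subseteq> transpose_mat ` dcoset n g"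
    by (rule image_mono)
  then have "dcoset n (transpose_mat g) \<subseteq> transpose_mat ` dcoset n g"
    by (simp add: image_image)
  with sub[OF assms] show ?thesis by blast
qed

section \<open>The double cosets moved by transposition\<close>

text \<open>For \<open>n \<ge> 1\<close> this is the transvection with an extra 1 at the start of
  the last row, a normal form for \<open>b = 0\<close>, \<open>c \<noteq> 0\<close>.\<close>

definition lower_rep :: "nat \<Rightarrow> 'a::field mat" where
  "lower_rep n = four_block_mat (1\<^sub>m n) (0\<^sub>m n 1) (transpose_mat (unit_col n)) (1\<^sub>m 1)"

lemma lower_rep_in_GL: "lower_rep n \<in> carrier (GL TYPE('a::field) (n + 1))"
proof -
  have car: "lower_rep n \<in> carrier_mat (n + 1) (n + 1)"
    unfolding lower_rep_def by (rule four_block_carrier_mat) simp_all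
  have "det (lower_rep n :: 'a mat) = det (1\<^sub>m n :: 'a mat) * det (1\<^sub>m 1 :: 'a mat)"
    unfolding lower_rep_def
    by (rule det_four_block_mat_upper_right_zero_col) (auto simp: unit_col_def)
  then show ?thesis using car by (simp add: mem_GL)
qed

text \<open>The orbit of \<open>lower_rep n\<close> has blocks \<open>a P Q\<close>,
  \<open>0\<close>, \<open>a\<close> times the first row of \<open>Q\<close>, and \<open>a\<close>.
  So \<open>a\<close> must be the entry of \<open>d\<close>, \<open>Q\<close> must have first row
  \<open>c / a\<close>, and then \<open>P\<close> is solved from the corner block.\<close>

lemma lower_block_in_dcoset:
  assumes A: "A \<in> carrier_mat n n" and c: "c \<in> carrier_mat 1 n" "c \<noteq> 0\<^sub>m 1 n"
    and d: "d \<in> carrier_mat 1 1"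
    and g: "four_block_mat A (0\<^sub>m n 1) c d \<in> carrier (GL TYPE('a::field) (n + 1))"
  shows "four_block_mat A (0\<^sub>m n 1) c d \<in> dcoset n (lower_rep n)"
proof -
  let ?d = "d $$ (0, 0)"
  \<comment> \<open>The zero block makes the determinant factor, so both \<open>A\<close> and the
    entry of \<open>d\<close> are invertible.\<close>
  have "det (four_block_mat A (0\<^sub>m n 1) c d) = det A * det d"
    by (rule det_four_block_mat_upper_right_zero_col[OF A refl c(1) d])
  moreover have deq: "d = ?d \<cdot>\<^sub>m 1\<^sub>m 1" using d by (intro eq_matI) auto
  ultimately have dA: "det A \<noteq> 0" and d0: "?d \<noteq> 0"
    using g deq by (auto simp: mem_GL det_smult)
  have "transpose_mat c \<noteq> 0\<^sub>m n 1" using c(2) by (metis transpose_transpose zero_transpose_mat)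
  then have ic: "inverse ?d \<cdot>\<^sub>m transpose_mat c \<noteq> 0\<^sub>m n 1"
    using d0 smult_smult_mat[of ?d "inverse ?d" "transpose_mat c"] by (auto simp: one_smult_mat smult_zero_mat)
  \<comment> \<open>The first row of \<open>?Q\<close> is prescribed through the first column of its
    transpose \<open>R\<close>.\<close>
  obtain R where R: "R \<in> carrier (GL TYPE('a) n)" "R * unit_col n = inverse ?d \<cdot>\<^sub>m transpose_mat c"
    using GL_transitive_on_nonzero[OF _ ic] c(1) by auto
  let ?Q = "transpose_mat R"
  have Q: "?Q \<in> carrier (GL TYPE('a) n)" using R(1) by simp
  obtain Q' where Q': "Q' \<in> carrier (GL TYPE('a) n)" "Q' * ?Q = 1\<^sub>m n"
    using GL_inverse[OF Q] by blast
  let ?P = "inverse ?d \<cdot>\<^sub>m (A * Q')"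
  have P: "?P \<in> carrier (GL TYPE('a) n)"
    using A dA d0 Q'(1) by (intro smult_in_GL mult_in_GL) (auto simp: mem_GL)
  note [simp] = GL_carrier_mat[OF R(1)] GL_carrier_mat[OF Q] GL_carrier_mat[OF Q'(1)] GL_carrier_mat[OF P]
  have "?P * 1\<^sub>m n * ?Q = inverse ?d \<cdot>\<^sub>m (A * Q' * ?Q)"
    using right_mult_one_mat[OF GL_carrier_mat[OF P]] A mult_smult_assoc_mat[of "A * Q'" n n ?Q n] by simp
  also have "A * Q' * ?Q = A"
    using assoc_mult_mat[of A n n Q' n ?Q n] A Q'(2) by simp
  finally have PQ: "?P * 1\<^sub>m n * ?Q = inverse ?d \<cdot>\<^sub>m A" .
  have P0: "?P * 0\<^sub>m n 1 = 0\<^sub>m n 1" by (rule right_mult_zero_mat[OF GL_carrier_mat[OF P]])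
  have cQ: "transpose_mat (unit_col n) * ?Q = inverse ?d \<cdot>\<^sub>m c"
    using transpose_mult[OF GL_carrier_mat[OF R(1)] unit_col_carrier] R(2) by (simp add: transpose_smult)
  have "GL_embed ?P * lower_rep n * GL_embed ?Q
      = four_block_mat (?P * 1\<^sub>m n * ?Q) (?P * 0\<^sub>m n 1) (transpose_mat (unit_col n) * ?Q) (1\<^sub>m 1)"
    unfolding lower_rep_def by (rule GL_embed_block_mult[OF GL_carrier_mat[OF P] GL_carrier_mat[OF Q]]) simp_all
  also have "\<dots> = four_block_mat (inverse ?d \<cdot>\<^sub>m A) (0\<^sub>m n 1) (inverse ?d \<cdot>\<^sub>m c) (1\<^sub>m 1)"
    unfolding PQ P0 cQ ..
  also have "?d \<cdot>\<^sub>m \<dots> = four_block_mat (?d \<cdot>\<^sub>m (inverse ?d \<cdot>\<^sub>m A)) (?d \<cdot>\<^sub>m 0\<^sub>m n 1)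
      (?d \<cdot>\<^sub>m (inverse ?d \<cdot>\<^sub>m c)) (?d \<cdot>\<^sub>m 1\<^sub>m 1)"
    using A c by (intro smult_four_block_mat) auto
  also have "\<dots> = four_block_mat A (0\<^sub>m n 1) c d"
    using d0 deq A c(1) by (intro cong_four_block_mat eq_matI) auto
  finally show ?thesis using dcosetI[OF d0 P Q] by metis
qed

text \<open>The upper right block changes only by left multiplication with \<open>P\<close> and by a
  scalar, so its vanishing is an invariant of the double coset.\<close>

lemma dcoset_lower_rep_last_col:
  assumes "x \<in> dcoset n (lower_rep n :: 'a::field mat)" "i < n"
  shows "x $$ (i, n) = 0"
proof -
  obtain a P Q where x: "x = a \<cdot>\<^sub>m (GL_embed P * lower_rep n * GL_embed Q)"
    "P \<in> carrier (GL TYPE('a) n)" "Q \<in> carrier (GL TYPE('a) n)"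
    using assms(1) by (auto simp: dcoset_def)
  note c = x(2,3)[THEN GL_carrier_mat]
  have "GL_embed P * lower_rep n * GL_embed Q
      = four_block_mat (P * 1\<^sub>m n * Q) (P * 0\<^sub>m n 1) (transpose_mat (unit_col n) * Q) (1\<^sub>m 1)"
    unfolding lower_rep_def by (rule GL_embed_block_mult[OF c]) simp_all
  then show ?thesis
    using c assms(2) right_mult_zero_mat[OF c(1), of 1] by (simp add: x(1))
qed

text \<open>The transpose has entry 1 at \<open>(0, n)\<close>, against that invariant;
  \<open>n \<ge> 1\<close> provides this off-diagonal position.\<close>

lemma transpose_lower_rep_notin_dcoset:
  assumes "n \<ge> 1"
  shows "transpose_mat (lower_rep n) \<notin> dcoset n (lower_rep n :: 'a::field mat)"
proof
  assume "transpose_mat (lower_rep n) \<in> dcoset n (lower_rep n :: 'a mat)"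
  then have "transpose_mat (lower_rep n :: 'a mat) $$ (0, n) = 0"
    using assms by (intro dcoset_lower_rep_last_col) auto
  then show False using assms by (simp add: lower_rep_def unit_col_def)
qed

lemma dcoset_not_transpose_invariant:
  assumes g: "g \<in> carrier (GL TYPE('a::field) (n + 1))"
    and ne: "transpose_mat ` dcoset n g \<noteq> dcoset n g"
  shows "dcoset n g = dcoset n (lower_rep n) \<or> dcoset n g = dcoset n (transpose_mat (lower_rep n))"
proof -
  have gc: "g \<in> carrier_mat (n + 1) (n + 1)" using g by (rule GL_carrier_mat)
  have Ec: "(lower_rep n :: 'a mat) \<in> carrier_mat (n + 1) (n + 1)"
    using lower_rep_in_GL by (rule GL_carrier_mat)
  obtain A b c d where split: "split_block g n n = (A, b, c, d)" by (metis prod_cases4)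
  note blk = split_block[OF split, of 1 1]
  have A: "A \<in> carrier_mat n n" and b: "b \<in> carrier_mat n 1" and c: "c \<in> carrier_mat 1 n"
    and d: "d \<in> carrier_mat 1 1" and geq: "g = four_block_mat A b c d"
    using blk gc by auto
  have gT: "transpose_mat g
      = four_block_mat (transpose_mat A) (transpose_mat c) (transpose_mat b) (transpose_mat d)"
    unfolding geq by (rule transpose_four_block_mat[OF A b c d])
  \<comment> \<open>If \<open>b\<close> and \<open>c\<close> vanished together or were both nonzero,
    the transpose of \<open>g\<close> would lie in the double coset of \<open>g\<close>, which would
    then be preserved.\<close>
  have "\<not> (b = 0\<^sub>m n 1 \<longleftrightarrow> c = 0\<^sub>m 1 n)"
  proof
    assume "b = 0\<^sub>m n 1 \<longleftrightarrow> c = 0\<^sub>m 1 n"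
    then obtain P Q where PQ: "P \<in> carrier (GL TYPE('a) n)" "Q \<in> carrier (GL TYPE('a) n)"
      "transpose_mat g = GL_embed P * g * GL_embed Q"
      using transpose_double_coset_equiv[OF A b c d] g unfolding geq by metis
    have "transpose_mat g = 1 \<cdot>\<^sub>m (GL_embed P * g * GL_embed Q)"
      unfolding PQ(3)[symmetric] one_smult_mat ..
    also have "\<dots> \<in> dcoset n g" using PQ(1,2) by (intro dcosetI) simp_all
    finally have "transpose_mat g \<in> dcoset n g" .
    then show False using ne transpose_dcoset[OF gc] dcoset_eqI[OF gc] by simp
  qed
  then consider "b = 0\<^sub>m n 1" "c \<noteq> 0\<^sub>m 1 n" | "b \<noteq> 0\<^sub>m n 1" "c = 0\<^sub>m 1 n" by blast
  then show ?thesis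
  proof cases
    case 1
    then have "g \<in> dcoset n (lower_rep n)"
      using lower_block_in_dcoset[OF A c _ d] g geq by simp
    then show ?thesis using dcoset_eqI[OF Ec] by simp
  next
    case 2
    \<comment> \<open>Transposing exchanges the roles of \<open>b\<close> and \<open>c\<close> and
      reduces to the first case; transposing the resulting double coset back gives the second
      representative.\<close>
    have "transpose_mat b \<noteq> 0\<^sub>m 1 n" using 2(1) by (metis transpose_transpose zero_transpose_mat)
    moreover have "transpose_mat c = 0\<^sub>m n 1" using 2(2) by simp
    ultimately have "transpose_mat g \<in> dcoset n (lower_rep n)"
      using lower_block_in_dcoset[of "transpose_mat A" n "transpose_mat b" "transpose_mat d"]
        transpose_in_GL[OF g] gT A b d by simp
    then have "transpose_mat ` dcoset n (transpose_mat g) = transpose_mat ` dcoset n (lower_rep n)"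
      using dcoset_eqI[OF Ec] by simp
    then show ?thesis
      using transpose_dcoset[OF Ec] transpose_dcoset[of "transpose_mat g" n] gc by simp
  qed
qed

section \<open>Counting the double cosets that are not preserved\<close>

theorem lemma1p4:
  fixes n :: nat
    and G :: "'a::{field,finite} mat monoid"
    and H :: "'a mat set"
  assumes "n \<ge> 1"
  defines "G \<equiv> GL TYPE('a) (n + 1)"
    and "H \<equiv> GL_sub TYPE('a) n"
  shows "card {D \<in> double_cosets G H (group_center G <#>\<^bsub>G\<^esub> H). transpose_mat ` D \<noteq> D} = 2"
proof -
  let ?E = "lower_rep n :: 'a mat"
  let ?T = "transpose_mat ?E"
  have E: "?E \<in> carrier (GL TYPE('a) (n + 1))" and T: "?T \<in> carrier (GL TYPE('a) (n + 1))"
    by (intro transpose_in_GL lower_rep_in_GL)+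
  note Ec = GL_carrier_mat[OF E] and Tc = GL_carrier_mat[OF T]
  have ne: "dcoset n ?E \<noteq> dcoset n ?T"
    using transpose_lower_rep_notin_dcoset[OF assms(1)] dcoset_self[OF Tc] by metis
  \<comment> \<open>Transposition swaps these two distinct double cosets, so neither is preserved,
    and the classification leaves no others.\<close>
  have ET: "transpose_mat ` dcoset n ?E = dcoset n ?T" "transpose_mat ` dcoset n ?T = dcoset n ?E"
    using transpose_dcoset[OF Ec] transpose_dcoset[OF Tc] by simp_all
  have "{D \<in> dcoset n ` carrier (GL TYPE('a) (n + 1)). transpose_mat ` D \<noteq> D} = {dcoset n ?E, dcoset n ?T}"
    (is "?L = ?R")
  proof
    show "?L \<subseteq> ?R" using dcoset_not_transpose_invariant by blast
    show "?R \<subseteq> ?L" using E T ET ne by auto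
  qed
  then show ?thesis
    unfolding G_def H_def double_cosets_GL using ne by simp
qed

end
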